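(* (1) There is no sequence $(f_n)\subset\mathcal B_0$ such that $\lim_{n\to\infty}\|f_ng-g\|_{\mathcal B_0}=0$ for all $g\in\mathcal B_0$. (2) $\mathcal M_s(\mathcal B_0)=\mathcal B$, where $\mathcal M_s(\mathcal B_0):=\{m\in\operatorname{Hol}(\mathbb C_+): mf\in\mathcal B_0\text{ for all }f\in\mathcal B_0\}$.
   Context: $\mathbb C_+=\{z:\Re z>0\}$, $\operatorname{Hol}(\mathbb C_+)$ the holomorphic functions on $\mathbb C_+$. $\mathcal B$ is the Banach algebra of holomorphic $f$ on $\mathbb C_+$ with $\|f\|_{\mathcal B_0}:=\int_0^\infty\sup_{\beta\in\mathbb R}|f'(\alpha+i\beta)|\,d\alpha<\infty$, with norm $\|f\|_{\mathcal B}=\sup_{\mathbb C_+}|f|+\|f\|_{\mathcal B_0}$; $f(\infty):=\lim_{\Re z\to\infty}f(z)$ exists, and $\mathcal B_0:=\{f\in\mathcal B:f(\infty)=0\}$ (a closed ideal of $\mathcal B$, on which $\|\cdot\|_{\mathcal B_0}$ is an equivalent norm). *)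

theory Defs
  imports "HOL-Complex_Analysis.Complex_Analysis"
begin

definition RHP :: "complex set" where
  "RHP = {z. 0 < Re z}"

definition B0_seminorm :: "(complex \<Rightarrow> complex) \<Rightarrow> ennreal" where
  "B0_seminorm f =
     (\<integral>\<^sup>+ a. (SUP b::real. ennreal (cmod (deriv f (Complex a b)))) * indicator {0<..} a \<partial>lborel)"

text \<open>The algebra B: bounded holomorphic functions on C_+ with finite B_0 seminorm.
  Only values on C_+ matter.\<close>
definition Bspace :: "(complex \<Rightarrow> complex) set" where
  "Bspace = {f. f holomorphic_on RHP \<and> bounded (f ` RHP) \<and> B0_seminorm f < \<infinity>}"

definition B0space :: "(complex \<Rightarrow> complex) set" where
  "B0space = {f \<in> Bspace. (f \<longlongrightarrow> 0) (filtercomap Re at_top)}"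

definition Ms_B0 :: "(complex \<Rightarrow> complex) set" where
  "Ms_B0 = {m. m holomorphic_on RHP \<and> (\<forall>f\<in>B0space. (\<lambda>z. m z * f z) \<in> B0space)}"

end

theory Submission
  imports Defs "HOL-Real_Asymp.Real_Asymp"
begin

text \<open>
  No approximate unit: on \<open>\<B>\<^sub>0\<close> the seminorm dominates the supremum norm, so testing against
  \<open>g(z) = e\<^sup>-\<^sup>z\<close> makes \<open>F\<^sub>n\<close> uniformly close to 1 on the line \<open>Re z = 1\<close>. As \<open>F\<^sub>n\<close> is bounded, the
  maximum principle (Phragmen-Lindelof) carries this to \<open>Re z \<ge> 1\<close>, contradicting \<open>F\<^sub>n(\<infinity>) = 0\<close>.

  Multipliers: \<open>\<bar>e\<^sup>-\<^sup>z\<bar>\<close> is bounded below on every strip \<open>0 < Re z \<le> x\<close>, so \<open>m e\<^sup>-\<^sup>z \<in> \<B>\<^sub>0\<close> controls \<open>m\<close>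
  and \<open>m'\<close> there, and a failure of \<open>m \<in> \<B>\<close> can only occur at \<open>Re z \<rightarrow> \<infinity>\<close>. It is excluded by a gliding
  hump: \<open>f(z) = \<Sum>\<^sub>k 4\<^sup>-\<^sup>k exp(-r\<^sub>k z)\<close> with rapidly decreasing \<open>r\<^sub>k\<close> lies in \<open>\<B>\<^sub>0\<close>, and on strips
  \<open>A\<^sub>k \<le> Re z \<le> B\<^sub>k\<close>, chosen so that \<open>m\<close> or the integral of \<open>sup \<bar>m'\<bar>\<close> is large there, its \<open>k\<close>-th
  term dominates; then \<open>m f\<close> cannot lie in \<open>\<B>\<^sub>0\<close>.
\<close>

section \<open>Suprema of the derivative on vertical lines, and the seminorm they define\<close>

definition deriv_sup :: "(complex \<Rightarrow> complex) \<Rightarrow> real \<Rightarrow> ennreal" where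
  "deriv_sup f a = (SUP b::real. ennreal (cmod (deriv f (Complex a b))))"

lemma B0_seminorm_eq:
  "B0_seminorm f = (\<integral>\<^sup>+ a. deriv_sup f a * indicator {0<..} a \<partial>lborel)"
  by (simp add: B0_seminorm_def deriv_sup_def)

lemma open_RHP: "open RHP"
  unfolding RHP_def by (simp add: open_halfspace_Re_gt)

lemma deriv_le_deriv_sup: "ennreal (cmod (deriv f z)) \<le> deriv_sup f (Re z)"
  unfolding deriv_sup_def by (rule SUP_upper2[where i="Im z"]) auto

lemma deriv_sup_leI:
  assumes "\<And>z. Re z = a \<Longrightarrow> ennreal (cmod (deriv f z)) \<le> C"
  shows "deriv_sup f a \<le> C"
  unfolding deriv_sup_def by (rule SUP_least) (simp add: assms)

text \<open>The supremum runs over uncountably many \<open>b\<close>, so measurability is not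
  automatic. But \<open>deriv f\<close> is continuous in the real part for each fixed
  \<open>b\<close>, so every strict superlevel set is a union of open sets: the supremum is lower
  semicontinuous.\<close>

lemma measurable_deriv_sup:
  assumes "f holomorphic_on RHP"
  shows "(\<lambda>a. deriv_sup f a * indicator {0<..} a) \<in> borel_measurable lborel"
proof (rule borel_measurableI_greater)
  fix y :: ennreal
  have *: "{x \<in> space lborel. y < deriv_sup f x * indicator {0<..} x} =
    (\<Union>b. {x \<in> {0<..}. y < ennreal (cmod (deriv f (Complex x b)))})"
    by (auto simp: deriv_sup_def less_SUP_iff split: split_indicator)
  have "open {x \<in> {0<..}. y < ennreal (cmod (deriv f (Complex x b)))}" for b
  proof -
    have "continuous_on {0<..} (\<lambda>x. deriv f (Complex x b))"
      by (rule continuous_on_compose2[OF holomorphic_on_imp_continuous_on[OF holomorphic_deriv[OF assms open_RHP]]])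
        (auto simp: Complex_eq RHP_def intro!: continuous_intros)
    then have "continuous_on {0<..} (\<lambda>x. ennreal (cmod (deriv f (Complex x b))))"
      by (intro continuous_on_ennreal continuous_on_norm)
    from continuous_open_preimage[OF this open_greaterThan open_greaterThan[of y]]
    show ?thesis by (simp add: vimage_def Int_def)
  qed
  then show "{x \<in> space lborel. y < deriv_sup f x * indicator {0<..} x} \<in> sets lborel"
    unfolding * by (auto intro!: borel_open)
qed

text \<open>Integrating \<open>deriv w\<close> along the horizontal ray from \<open>z\<close>
  recovers \<open>w z\<close>, because \<open>w\<close> vanishes at infinity. This turns seminorm
  convergence into uniform convergence.\<close>

lemma norm_le_B0_seminorm:
  assumes hol: "w holomorphic_on RHP"
    and lim: "(w \<longlongrightarrow> 0) (filtercomap Re at_top)"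
    and z: "z \<in> RHP"
  shows "ennreal (cmod (w z)) \<le> B0_seminorm w"
proof -
  define \<gamma> where "\<gamma> t = Complex t (Im z)" for t
  have \<gamma>_eq: "\<gamma> t = of_real t + \<i> * of_real (Im z)" for t
    by (simp add: \<gamma>_def complex_eq_iff)
  have d: "(w has_field_derivative deriv w u) (at u)" if "u \<in> RHP" for u
    using hol open_RHP that by (rule holomorphic_derivI)
  have bound: "ennreal (cmod (w (\<gamma> T) - w z)) \<le> B0_seminorm w" if T: "Re z \<le> T" for T
  proof -
    let ?I = "{Re z..T}"
    have sub: "\<gamma> ` ?I \<subseteq> RHP"
      using z by (auto simp: \<gamma>_def RHP_def)
    have vd: "((\<lambda>t. w (\<gamma> t)) has_vector_derivative deriv w (\<gamma> t)) (at t within ?I)" if "t \<in> ?I" for t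
    proof -
      have "(\<gamma> has_vector_derivative 1) (at t)"
        unfolding \<gamma>_eq by (auto intro!: derivative_eq_intros)
      moreover have "\<gamma> t \<in> RHP" using sub that by auto
      ultimately have "(w \<circ> \<gamma> has_vector_derivative 1 * deriv w (\<gamma> t)) (at t)"
        by (intro field_vector_diff_chain_at d)
      then show ?thesis
        by (simp add: o_def has_vector_derivative_at_within)
    qed
    have cont: "continuous_on ?I (\<lambda>t. deriv w (\<gamma> t))"
      by (rule continuous_on_compose2[OF holomorphic_on_imp_continuous_on[OF holomorphic_deriv[OF hol open_RHP]] _ sub])
        (auto simp: \<gamma>_eq intro!: continuous_intros)
    have bi: "has_bochner_integral lborel (\<lambda>x. indicator ?I x *\<^sub>R deriv w (\<gamma> x)) (w (\<gamma> T) - w (\<gamma> (Re z)))"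
      using T vd cont by (intro has_bochner_integral_FTC_Icc) auto
    then have "ennreal (cmod (w (\<gamma> T) - w (\<gamma> (Re z)))) \<le> (\<integral>\<^sup>+ x. norm (indicator ?I x *\<^sub>R deriv w (\<gamma> x)) \<partial>lborel)"
      by (rule has_bochner_integral_norm_bound)
    also have "\<dots> \<le> B0_seminorm w"
      unfolding B0_seminorm_eq
    proof (rule nn_integral_mono)
      fix x show "ennreal (norm (indicator ?I x *\<^sub>R deriv w (\<gamma> x))) \<le> deriv_sup w x * indicator {0<..} x"
        using z deriv_le_deriv_sup[of w "\<gamma> x"]
        by (auto simp: RHP_def \<gamma>_def split: split_indicator)
    qed
    finally show ?thesis by (simp add: \<gamma>_def)
  qed
  \<comment> \<open>\<open>filtercomap Re at_top\<close> expresses a limit as the real part tends to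
    infinity, uniformly in the imaginary part; a horizontal ray is one way of approaching
    it.\<close>
  have "filterlim (\<lambda>t. \<gamma> t) (filtercomap Re at_top) at_top"
    by (simp add: filterlim_filtercomap_iff o_def \<gamma>_def filterlim_ident)
  then have "((\<lambda>t. w (\<gamma> t)) \<longlongrightarrow> 0) at_top"
    by (rule filterlim_compose[OF lim])
  then have "((\<lambda>t. ennreal (cmod (w (\<gamma> t) - w z))) \<longlongrightarrow> ennreal (cmod (0 - w z))) at_top"
    by (intro tendsto_intros)
  then have "ennreal (cmod (0 - w z)) \<le> B0_seminorm w"
    by (rule tendsto_upperbound) (auto intro: eventually_mono[OF eventually_ge_at_top[of "Re z"]] bound)
  then show ?thesis by simp
qed

section \<open>Maximum principle for bounded functions on a half-plane\<close>

text \<open>The bound \<open>M\<close> may be far larger than \<open>B\<close>; its purpose is to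
  exclude functions like \<open>exp (z - c)\<close>, which has modulus 1 on the boundary line and
  grows inside.\<close>

lemma halfplane_maximum_modulus:
  assumes hol: "u holomorphic_on {z. c < Re z}"
    and cont: "continuous_on {z. c \<le> Re z} u"
    and M: "\<And>z. c \<le> Re z \<Longrightarrow> cmod (u z) \<le> M"
    and bd: "\<And>z. Re z = c \<Longrightarrow> cmod (u z) \<le> B"
    and B: "0 < B" and z: "c \<le> Re z"
  shows "cmod (u z) \<le> B"
proof -
  \<comment> \<open>Dividing by \<open>1 + \<epsilon> (z - c)\<close> makes the bounded function small on large arcs.\<close>
  have eps: "cmod (u z) \<le> B * cmod (1 + of_real \<epsilon> * (z - of_real c))" if \<epsilon>: "0 < \<epsilon>" for \<epsilon>
  proof -
    define q where "q y = 1 + of_real \<epsilon> * (y - of_real c)" for y :: complex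
    have Re_q: "Re (q y) = 1 + \<epsilon> * (Re y - c)" for y by (simp add: q_def)
    have q1: "1 \<le> cmod (q y)" if "c \<le> Re y" for y
    proof -
      have "1 \<le> Re (q y)" using that \<epsilon> by (simp add: Re_q)
      then show ?thesis using complex_Re_le_cmod[of "q y"] by linarith
    qed
    have q0: "q y \<noteq> 0" if "c \<le> Re y" for y using q1[OF that] by auto
    \<comment> \<open>The first summand makes \<open>\<epsilon> * R - 1\<close> at least
      \<open>M / B\<close>, so the quotient is at most \<open>B\<close> on the arc; the second keeps
      \<open>z\<close> inside the disc.\<close>
    define R where "R = (\<bar>M\<bar> / B + 1) / \<epsilon> + cmod (z - of_real c)"
    have M0: "0 \<le> M" using M[OF z] norm_ge_zero order_trans by blast
    let ?S = "{y. c \<le> Re y} \<inter> cball (of_real c) R"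
    have cl: "closed ?S" by (intro closed_Int closed_halfspace_Re_ge closed_cball)
    have int: "interior ?S = {y. c < Re y} \<inter> ball (of_real c) R"
      using interior_halfspace_ge[of "1::complex" c] by (simp add: interior_Int)
    have "cmod (u z / q z) \<le> B"
    proof (rule maximum_modulus_frontier[where S="?S" and f="\<lambda>y. u y / q y"])
      show "(\<lambda>y. u y / q y) holomorphic_on interior ?S"
        unfolding int using q0
        by (intro holomorphic_intros holomorphic_on_subset[OF hol])
          (auto simp: q_def[abs_def] intro!: holomorphic_intros)
      show "continuous_on (closure ?S) (\<lambda>y. u y / q y)"
        unfolding closure_closed[OF cl] using q0
        by (intro continuous_intros continuous_on_subset[OF cont])
          (auto simp: q_def[abs_def] intro!: continuous_intros)
      show "bounded ?S" by (simp add: bounded_Int)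
      show "z \<in> ?S" using z \<epsilon> B M0 by (auto simp: R_def dist_norm norm_minus_commute)
      fix y assume y: "y \<in> frontier ?S"
      then have y1: "c \<le> Re y" "dist (of_real c) y \<le> R"
        and y2: "Re y = c \<or> dist (of_real c) y = R"
        unfolding frontier_def closure_closed[OF cl] int by auto
      show "cmod (u y / q y) \<le> B"
      proof (cases "Re y = c")
        case True
        have "cmod (u y) \<le> B * 1" using bd[OF True] by simp
        also have "\<dots> \<le> B * cmod (q y)" using q1[OF y1(1)] B by (intro mult_left_mono) auto
        finally show ?thesis using q0[OF y1(1)] by (simp add: norm_divide divide_le_eq)
      next
        case False
        then have r: "cmod (y - of_real c) = R" using y2 by (simp add: dist_norm norm_minus_commute)
        have "M / B \<le> \<epsilon> * R - 1"
          using \<epsilon> M0 by (simp add: R_def field_simps)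
        also have "\<dots> = cmod (of_real \<epsilon> * (y - of_real c)) - cmod 1"
          using \<epsilon> by (simp add: norm_mult r)
        also have "\<dots> \<le> cmod (q y)"
          unfolding q_def by (metis add.commute norm_diff_ineq)
        finally have "M \<le> B * cmod (q y)" using B by (simp add: field_simps)
        then have "cmod (u y) \<le> B * cmod (q y)" using M[OF y1(1)] by linarith
        then show ?thesis using q0[OF y1(1)] by (simp add: norm_divide divide_le_eq)
      qed
    qed
    then show ?thesis using q0[OF z] by (simp add: norm_divide divide_le_eq q_def)
  qed
  have "((\<lambda>\<epsilon>::real. B * cmod (1 + of_real \<epsilon> * (z - of_real c))) \<longlongrightarrow> B * cmod (1 + of_real 0 * (z - of_real c))) (at_right 0)"
    by (intro tendsto_intros)
  then have "cmod (u z) \<le> B * cmod (1 + of_real 0 * (z - of_real c))"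
    by (rule tendsto_lowerbound) (auto simp: eventually_at_filter eps)
  then show ?thesis by simp
qed

section \<open>Series of decaying exponentials\<close>

text \<open>The integrand is the modulus of the derivative of \<open>exp (- r * z)\<close> on the
  line of real part \<open>a\<close>. Every such exponential therefore has seminorm 1, whatever its
  rate, which leaves the rates free in the later construction.\<close>

lemma nn_integral_exp:
  fixes r :: real assumes "0 < r"
  shows "(\<integral>\<^sup>+ a. ennreal (r * exp (- r * a)) * indicator {0..} a \<partial>lborel) = 1"
proof -
  have "((\<lambda>a. - exp (- r * a)) \<longlongrightarrow> - 0) at_top"
    using assms by real_asymp
  then have "(\<integral>\<^sup>+ a. ennreal (r * exp (- r * a)) * indicator {0..} a \<partial>lborel) = ennreal (-0 - - exp (- r * 0))"
    using assms by (intro nn_integral_FTC_atLeast) (auto intro!: derivative_eq_intros)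
  then show ?thesis by simp
qed

text \<open>Each exponential has modulus at most 1 and seminorm 1, so both the supremum and the
  seminorm of the series are at most \<open>suminf c\<close>.\<close>

lemma exp_series_in_B0space:
  fixes c r :: "nat \<Rightarrow> real"
  assumes c0: "\<And>k. 0 \<le> c k" and sc: "summable c" and r0: "\<And>k. 0 < r k"
    and sums: "\<And>z. z \<in> RHP \<Longrightarrow> (\<lambda>k. of_real (c k) * exp (- of_real (r k) * z)) sums f z"
  shows "f \<in> B0space"
proof -
  let ?t = "\<lambda>k z. of_real (c k) * exp (- of_real (r k) * z) :: complex"
  have nt: "cmod (?t k z) = c k * exp (- r k * Re z)" for k z
    using c0 by (simp add: norm_mult)
  have ntc: "cmod (?t k z) \<le> c k" if "0 \<le> Re z" for k z
    unfolding nt using c0[of k] r0[of k] that by (simp add: mult_left_le)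
  have "\<exists>g g'. \<forall>z\<in>RHP. (\<lambda>k. ?t k z) sums g z \<and>
      (\<lambda>k. - of_real (r k) * ?t k z) sums g' z \<and> (g has_field_derivative g' z) (at z)"
  \<comment> \<open>The majorant \<open>c\<close> is valid on the whole half-plane, so the radius 1
    of the ball is an arbitrary choice.\<close>
  proof (rule series_and_derivative_comparison_complex[OF open_RHP])
    fix k and z :: complex
    show "(?t k has_field_derivative - of_real (r k) * ?t k z) (at z)"
      by (auto intro!: derivative_eq_intros)
  next
    fix z :: complex
    show "\<exists>d h. 0 < d \<and> summable h \<and> range h \<subseteq> \<real>\<^sub>\<ge>\<^sub>0 \<and>
      (\<forall>\<^sub>F k in sequentially. \<forall>y\<in>ball z d \<inter> RHP. cmod (?t k y) \<le> cmod (h k))"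
      using ntc c0 sc by (intro exI[of _ 1] exI[of _ "\<lambda>k. of_real (c k) :: complex"])
        (auto simp: RHP_def summable_of_real)
  qed
  then obtain g g' where g: "\<And>z. z \<in> RHP \<Longrightarrow> (\<lambda>k. ?t k z) sums g z"
    and g': "\<And>z. z \<in> RHP \<Longrightarrow> (\<lambda>k. - of_real (r k) * ?t k z) sums g' z"
    and gd: "\<And>z. z \<in> RHP \<Longrightarrow> (g has_field_derivative g' z) (at z)" by blast
  have fg: "f z = g z" if "z \<in> RHP" for z
    using sums[OF that] g[OF that] by (rule sums_unique2)
  have fd: "(f has_field_derivative g' z) (at z)" if "z \<in> RHP" for z
    using gd[OF that] open_RHP that fg[symmetric] by (rule has_field_derivative_transform_within_open)
  have df: "deriv f z = g' z" if "z \<in> RHP" for z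
    using fd[OF that] by (rule DERIV_imp_deriv)
  have hol: "f holomorphic_on RHP"
    using fd by (auto simp: holomorphic_on_def field_differentiable_def intro: has_field_derivative_at_within)
  have bound: "cmod (f z) \<le> suminf (\<lambda>k. c k * exp (- r k * Re z))" if "z \<in> RHP" for z
  proof -
    have "summable (\<lambda>k. norm (?t k z))"
      using sc ntc that by (intro summable_comparison_test[OF _ sc]) (auto simp: RHP_def)
    from summable_norm[OF this] show ?thesis
      using sums_unique[OF sums[OF that]] unfolding nt by simp
  qed
  have sume: "summable (\<lambda>k. c k * exp (- r k * a))" if "0 \<le> a" for a
    using c0 ntc[of "of_real a"] that unfolding nt by (intro summable_comparison_test[OF _ sc]) (auto intro!: exI[of _ 0])
  have bdd: "bounded (f ` RHP)"
    unfolding bounded_iff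
  proof (intro exI ballI)
    fix y assume "y \<in> f ` RHP"
    then obtain z where z: "z \<in> RHP" "y = f z" by auto
    have "suminf (\<lambda>k. c k * exp (- r k * Re z)) \<le> suminf c"
      using z c0 r0 by (intro suminf_le sume sc) (auto simp: RHP_def mult_left_le less_imp_le)
    then show "norm y \<le> suminf c" using bound[OF z(1)] z by simp
  qed
  have "B0_seminorm f \<le> (\<integral>\<^sup>+ a. (\<Sum>k. ennreal (c k) * (ennreal (r k * exp (- r k * a)) * indicator {0..} a)) \<partial>lborel)"
    unfolding B0_seminorm_eq
  proof (rule nn_integral_mono)
    fix a :: real
    show "deriv_sup f a * indicator {0<..} a \<le> (\<Sum>k. ennreal (c k) * (ennreal (r k * exp (- r k * a)) * indicator {0..} a))"
    proof (cases "0 < a")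
      case True
      have "deriv_sup f a \<le> (\<Sum>k. ennreal (c k) * ennreal (r k * exp (- r k * a)))"
      proof (rule deriv_sup_leI)
        fix z :: complex assume z: "Re z = a"
        then have zR: "z \<in> RHP" using True by (simp add: RHP_def)
        have n: "ennreal (c k) * ennreal (r k * exp (- r k * a)) = ennreal (cmod (- of_real (r k) * ?t k z))" for k
          using c0[of k] r0[of k] z by (simp add: norm_mult ennreal_mult'[symmetric] mult_ac)
        show "ennreal (cmod (deriv f z)) \<le> (\<Sum>k. ennreal (c k) * ennreal (r k * exp (- r k * a)))"
        \<comment> \<open>If the differentiated series does not converge absolutely, the right-hand
          side is infinite and the bound is trivial; this avoids any estimate on the rates.\<close>
        proof (cases "summable (\<lambda>k. cmod (- of_real (r k) * ?t k z))")
          case s: True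
          then show ?thesis
            unfolding n df[OF zR] using summable_norm[OF s] sums_unique[OF g'[OF zR]]
            by (subst suminf_ennreal2) (auto intro!: ennreal_leI)
        next
          case False
          then have "(\<Sum>k. ennreal (cmod (- of_real (r k) * ?t k z))) = top"
            by (rule contrapos_np) (rule summable_suminf_not_top, rule norm_ge_zero)
          then show ?thesis unfolding n by (simp only: top_greatest)
        qed
      qed
      then show ?thesis using True by simp
    qed simp
  qed
  also have "\<dots> = (\<Sum>k. \<integral>\<^sup>+ a. ennreal (c k) * (ennreal (r k * exp (- r k * a)) * indicator {0..} a) \<partial>lborel)"
    by (rule nn_integral_suminf) measurable
  also have "\<dots> = (\<Sum>k. ennreal (c k))"
    using nn_integral_exp[OF r0] by (subst nn_integral_cmult) (auto simp del: mult_minus_left)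
  also have "\<dots> < \<infinity>"
    using sc c0 by (simp add: suminf_ennreal2)
  finally have fin: "B0_seminorm f < \<infinity>" .
  \<comment> \<open>Each term tends to 0 and is dominated by \<open>c k\<close> for nonnegative
    \<open>a\<close>, so the limit may be taken termwise.\<close>
  have "((\<lambda>a. \<Sum>k. c k * exp (- r k * a)) \<longlongrightarrow> suminf (\<lambda>k. 0)) at_top"
  proof (rule tannerys_theorem[THEN conjunct2, THEN conjunct2])
    fix k
    show "((\<lambda>a. c k * exp (- r k * a)) \<longlongrightarrow> 0) at_top"
      using r0[of k] by real_asymp
    show "\<forall>\<^sub>F (k, a) in at_top \<times>\<^sub>F at_top. norm (c k * exp (- r k * a)) \<le> c k"
      unfolding eventually_prod_filter
      by (rule exI[of _ "\<lambda>_. True"], rule exI[of _ "\<lambda>a. 0 \<le> a"])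
        (use c0 r0 in \<open>auto simp: abs_mult mult_left_le less_imp_le eventually_ge_at_top\<close>)
  qed (use sc in auto)
  then have "((\<lambda>z. \<Sum>k. c k * exp (- r k * Re z)) \<longlongrightarrow> 0) (filtercomap Re at_top)"
    by (auto intro: filterlim_compose[OF _ filterlim_filtercomap])
  then have "(f \<longlongrightarrow> 0) (filtercomap Re at_top)"
    by (rule Lim_null_comparison[rotated])
      (use bound in \<open>auto simp: RHP_def intro: eventually_filtercomapI[OF eventually_gt_at_top[of 0], THEN eventually_mono]\<close>)
  then show ?thesis using hol bdd fin by (simp add: B0space_def Bspace_def)
qed

text \<open>A series with one nonzero coefficient. It is the test function for the approximate unit
  and controls multipliers where the real part is bounded.\<close>

lemma exp_minus_in_B0space: "(\<lambda>z. exp (- z)) \<in> B0space"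
proof (rule exp_series_in_B0space[where c="\<lambda>k. if k = 0 then 1 else 0" and r="\<lambda>_. 1"])
  fix z :: complex
  have "(\<lambda>k. if k = 0 then exp (- z) else 0) sums exp (- z)"
    by (rule sums_single)
  then show "(\<lambda>k. of_real (if k = (0::nat) then 1 else 0) * exp (- of_real 1 * z)) sums exp (- z)"
    by (rule back_subst[of "\<lambda>h. h sums exp (- z)"]) auto
qed auto


section \<open>The gliding hump\<close>

text \<open>\<open>N k x\<close> prescribes where the \<open>k\<close>-th strip must end if it
  begins at \<open>x\<close>. The beginnings \<open>A k\<close> are chosen here, recursively, since
  each depends on where the previous strip ended.\<close>

lemma gliding_hump_function:
  fixes N :: "nat \<Rightarrow> real \<Rightarrow> real"
  assumes N: "\<And>k x. x \<le> N k x"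
  obtains f A where "f \<in> B0space"
    and "\<And>k z. \<lbrakk>z \<in> RHP; A k \<le> Re z; Re z \<le> N k (A k)\<rbrakk> \<Longrightarrow> 1 / 4 ^ (k + 1) \<le> cmod (f z)"
proof -
  \<comment> \<open>\<open>A (k + 1)\<close> is so large that all terms up to \<open>k\<close> have decayed below \<open>4\<^sup>-\<^sup>k\<^sup>-\<^sup>3\<close> times their
     coefficient, while \<open>r k\<close> is so small that term \<open>k\<close> has hardly decayed up to \<open>B k\<close>.\<close>
  define A where "A = rec_nat 1 (\<lambda>k x. 6 * 4 ^ (k + 3) * N k x)"
  define B where "B k = N k (A k)" for k
  define r where "r k = 1 / (6 * B k)" for k
  define c where "c k = (1/4 :: real) ^ k" for k
  have A_Suc: "A (Suc k) = 6 * 4 ^ (k + 3) * B k" for k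
    by (simp add: A_def B_def)
  have AB: "A k \<le> B k" for k by (simp add: B_def N)
  have grow: "B k \<le> A (Suc k)" if "1 \<le> B k" for k
  proof -
    have "1 \<le> 6 * (4::real) ^ (k + 3)"
      using one_le_power[of "4::real" "k + 3"] by linarith
    then have "1 * B k \<le> (6 * 4 ^ (k + 3)) * B k"
      using that by (intro mult_right_mono) linarith+
    then show ?thesis by (simp add: A_Suc)
  qed
  have A1: "1 \<le> A k" for k
  proof (induction k)
    case (Suc k) then show ?case using AB[of k] grow[of k] by linarith
  qed (simp add: A_def)
  have B1: "1 \<le> B k" for k using A1[of k] AB[of k] by linarith
  have B_mono: "B j \<le> B k" if "j \<le> k" for j k
    using that by (rule lift_Suc_mono_le[rotated]) (meson AB B1 grow order_trans)
  have r0: "0 < r k" for k using B1[of k] by (simp add: r_def)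
  have c0: "0 \<le> c k" for k by (simp add: c_def)
  have sc: "summable c" unfolding c_def by (intro summable_geometric) simp
  have suminf_c: "suminf c = 4/3" unfolding c_def by (subst suminf_geometric) auto
  define t where "t k z = of_real (c k) * exp (- of_real (r k) * z)" for k and z :: complex
  define f where "f z = (\<Sum>k. t k z)" for z
  have nt: "cmod (t k z) = c k * exp (- r k * Re z)" for k z
    using c0 by (simp add: t_def norm_mult)
  have ntc: "cmod (t k z) \<le> c k" if "z \<in> RHP" for k z
    unfolding nt using c0[of k] r0[of k] that by (simp add: mult_left_le RHP_def)
  have st: "summable (\<lambda>k. cmod (t k z))" if "z \<in> RHP" for z
    using ntc[OF that] by (intro summable_comparison_test[OF _ sc]) auto
  have fB: "f \<in> B0space"
  proof (rule exp_series_in_B0space[OF c0 sc r0])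
    fix z assume "z \<in> RHP"
    then show "(\<lambda>k. of_real (c k) * exp (- of_real (r k) * z)) sums f z"
      using summable_sums[OF summable_norm_cancel[OF st]] by (simp add: f_def t_def)
  qed
  have "1 / 4 ^ (k + 1) \<le> cmod (f z)" if z: "z \<in> RHP" "A k \<le> Re z" "Re z \<le> N k (A k)" for k z
  proof -
    \<comment> \<open>The terms after \<open>k\<close> amount to at most \<open>c k / 3\<close>,
      those before to at most \<open>c k / 12\<close>, while term \<open>k\<close> has modulus at
      least \<open>5/6 * c k\<close>. This leaves \<open>5/12 * c k\<close>, more than the required
      \<open>c k / 4\<close>.\<close>
    have "f z = (\<Sum>j. t (j + Suc k) z) + (\<Sum>j<Suc k. t j z)"
      unfolding f_def by (rule suminf_split_initial_segment[OF summable_norm_cancel[OF st[OF z(1)]]])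
    then have split: "t k z = f z - (\<Sum>j. t (j + Suc k) z) - (\<Sum>j<k. t j z)" by simp
    have st': "summable (\<lambda>j. cmod (t (j + Suc k) z))"
      using st[OF z(1)] by (rule summable_ignore_initial_segment)
    have sc': "summable (\<lambda>j. c (j + Suc k))"
      using sc by (rule summable_ignore_initial_segment)
    have "cmod (\<Sum>j. t (j + Suc k) z) \<le> (\<Sum>j. cmod (t (j + Suc k) z))"
      by (rule summable_norm[OF st'])
    also have "\<dots> \<le> (\<Sum>j. c (j + Suc k))"
      by (rule suminf_le[OF _ st' sc']) (rule ntc[OF z(1)])
    also have "\<dots> = (\<Sum>j. c (Suc k) * c j)"
      by (simp add: c_def power_add mult_ac)
    also have "\<dots> = c k / 3"
      unfolding suminf_mult[OF sc] suminf_c by (simp add: c_def)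
    finally have tail: "cmod (\<Sum>j. t (j + Suc k) z) \<le> c k / 3" .
    have "cmod (\<Sum>j<k. t j z) \<le> (\<Sum>j<k. c j * (c k / 16))"
    proof (rule sum_norm_le)
      fix j assume j: "j \<in> {..<k}"
      then obtain i where i: "k = Suc i" "j \<le> i" by (cases k) auto
      \<comment> \<open>Since \<open>k = Suc i\<close>, the exponent \<open>i + 3\<close> in the
        recursion for \<open>A\<close> equals \<open>k + 2\<close>. Hence \<open>r j * Re z\<close>
        is at least \<open>4 ^ (k + 2)\<close>, and \<open>exp x \<ge> 1 + x\<close> gives the decay
        factor \<open>c k / 16\<close>.\<close>
      have "4 ^ (k + 2) * (6 * B j) \<le> 4 ^ (k + 2) * (6 * B i)"
        using B_mono[OF i(2)] by simp
      also have "\<dots> = A k" by (simp add: i(1) A_Suc power_add)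
      also have "\<dots> \<le> Re z" by (rule z(2))
      finally have le: "4 ^ (k + 2) \<le> r j * Re z"
        using B1[of j] by (simp add: r_def field_simps)
      have "exp (- r j * Re z) = 1 / exp (r j * Re z)" by (simp add: exp_minus field_simps)
      also have "\<dots> \<le> 1 / 4 ^ (k + 2)"
        using le exp_ge_add_one_self[of "r j * Re z"]
        by (intro divide_left_mono) (linarith, auto)
      also have "\<dots> = c k / 16" by (simp add: c_def power_add field_simps)
      finally show "cmod (t j z) \<le> c j * (c k / 16)"
        unfolding nt using c0[of j] by (intro mult_left_mono) auto
    qed
    also have "\<dots> = (\<Sum>j<k. c j) * (c k / 16)" by (simp add: sum_distrib_right)
    also have "\<dots> \<le> 4/3 * (c k / 16)"
      using sum_le_suminf[OF sc, of "{..<k}"] c0 suminf_c by (intro mult_right_mono) auto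
    finally have head: "cmod (\<Sum>j<k. t j z) \<le> c k / 12" by simp
    \<comment> \<open>On the strip \<open>Re z \<le> B k\<close>; the 6 in the definition of
      \<open>r\<close> makes the exponent at most 1/6, and
      \<open>exp (- 1/6) \<ge> 5/6\<close>.\<close>
    have "r k * Re z \<le> 1 / 6"
      using z(3) B1[of k] by (simp add: r_def B_def[symmetric] field_simps)
    then have "5 / 6 \<le> exp (- r k * Re z)"
      using exp_ge_add_one_self[of "- r k * Re z"] by simp
    then have "c k * (5 / 6) \<le> cmod (t k z)"
      unfolding nt using c0[of k] by (intro mult_left_mono)
    moreover have "cmod (t k z) \<le> cmod (f z) + cmod (\<Sum>j. t (j + Suc k) z) + cmod (\<Sum>j<k. t j z)"
      unfolding split by (intro norm_triangle_ineq4[THEN order_trans] add_right_mono norm_triangle_ineq4)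
    ultimately have "c k / 4 \<le> cmod (f z)" using head tail c0[of k] by simp
    then show ?thesis by (simp add: c_def field_simps power_one_over)
  qed
  with fB show thesis by (rule that)
qed

section \<open>Elements of B are multipliers\<close>

lemma deriv_mult_RHP:
  assumes "m holomorphic_on RHP" "f holomorphic_on RHP" "z \<in> RHP"
  shows "deriv (\<lambda>z. m z * f z) z = m z * deriv f z + deriv m z * f z"
  using assms open_RHP by (intro deriv_mult) (auto intro: holomorphic_on_imp_differentiable_at)

lemma bounded_imageE:
  assumes "bounded (f ` S)"
  obtains M :: real where "0 < M" "\<And>z. z \<in> S \<Longrightarrow> norm (f z) \<le> M"
  using assms unfolding bounded_pos by auto

text \<open>By the product rule the seminorm of the product is at most \<open>M\<close> times that
  of \<open>f\<close> plus \<open>K\<close> times that of \<open>m\<close>, with \<open>M\<close>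
  and \<open>K\<close> bounding \<open>m\<close> and \<open>f\<close>. The limit 0 comes from
  \<open>f\<close>, as \<open>m\<close> is bounded.\<close>

lemma mult_in_B0space:
  assumes m: "m \<in> Bspace" and f: "f \<in> B0space"
  shows "(\<lambda>z. m z * f z) \<in> B0space"
proof -
  have mh: "m holomorphic_on RHP" and fh: "f holomorphic_on RHP"
    and ms: "B0_seminorm m < \<infinity>" and fs: "B0_seminorm f < \<infinity>"
    and fl: "(f \<longlongrightarrow> 0) (filtercomap Re at_top)"
    using m f by (auto simp: B0space_def Bspace_def)
  obtain M where M: "0 < M" "\<And>z. z \<in> RHP \<Longrightarrow> norm (m z) \<le> M"
    using m by (auto simp: Bspace_def elim: bounded_imageE)
  obtain K where K: "0 < K" "\<And>z. z \<in> RHP \<Longrightarrow> norm (f z) \<le> K"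
    using f by (auto simp: B0space_def Bspace_def elim: bounded_imageE)
  have hol: "(\<lambda>z. m z * f z) holomorphic_on RHP"
    by (intro holomorphic_intros mh fh)
  have "norm (m z * f z) \<le> M * K" if "z \<in> RHP" for z
    unfolding norm_mult using M K that by (intro mult_mono) auto
  then have bdd: "bounded ((\<lambda>z. m z * f z) ` RHP)"
    unfolding bounded_iff by blast
  note [measurable] = measurable_deriv_sup[OF mh] measurable_deriv_sup[OF fh]
  have "B0_seminorm (\<lambda>z. m z * f z) \<le> (\<integral>\<^sup>+ a. ennreal M * (deriv_sup f a * indicator {0<..} a) +
      ennreal K * (deriv_sup m a * indicator {0<..} a) \<partial>lborel)"
    unfolding B0_seminorm_eq
  proof (rule nn_integral_mono)
    fix a :: real
    have "deriv_sup (\<lambda>z. m z * f z) a \<le> ennreal M * deriv_sup f a + ennreal K * deriv_sup m a" if "0 < a"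
    proof (rule deriv_sup_leI)
      fix z :: complex assume z: "Re z = a"
      then have zR: "z \<in> RHP" using that by (simp add: RHP_def)
      have "cmod (deriv (\<lambda>z. m z * f z) z) \<le> cmod (m z) * cmod (deriv f z) + cmod (deriv m z) * cmod (f z)"
        unfolding deriv_mult_RHP[OF mh fh zR] by (metis norm_mult norm_triangle_ineq)
      also have "\<dots> \<le> M * cmod (deriv f z) + cmod (deriv m z) * K"
        using M K zR by (intro add_mono mult_mono) auto
      finally have "ennreal (cmod (deriv (\<lambda>z. m z * f z) z)) \<le> ennreal (M * cmod (deriv f z) + K * cmod (deriv m z))"
        by (simp add: ennreal_leI mult.commute)
      also have "\<dots> = ennreal M * ennreal (cmod (deriv f z)) + ennreal K * ennreal (cmod (deriv m z))"
        using M K by (simp add: ennreal_plus ennreal_mult)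
      also have "\<dots> \<le> ennreal M * deriv_sup f a + ennreal K * deriv_sup m a"
        using deriv_le_deriv_sup z by (intro add_mono mult_left_mono) auto
      finally show "ennreal (cmod (deriv (\<lambda>z. m z * f z) z)) \<le> ennreal M * deriv_sup f a + ennreal K * deriv_sup m a" .
    qed
    then show "deriv_sup (\<lambda>z. m z * f z) a * indicator {0<..} a \<le>
      ennreal M * (deriv_sup f a * indicator {0<..} a) + ennreal K * (deriv_sup m a * indicator {0<..} a)"
      by (auto split: split_indicator)
  qed
  also have "\<dots> = ennreal M * B0_seminorm f + ennreal K * B0_seminorm m"
    unfolding B0_seminorm_eq by (simp add: nn_integral_add nn_integral_cmult)
  also have "\<dots> < \<infinity>"
    using ms fs by (simp add: ennreal_mult_less_top)
  finally have sn: "B0_seminorm (\<lambda>z. m z * f z) < \<infinity>" .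
  have RHP_ev: "\<forall>\<^sub>F z in filtercomap Re at_top. z \<in> RHP"
    unfolding RHP_def mem_Collect_eq by (rule eventually_filtercomapI[OF eventually_gt_at_top])
  have "((\<lambda>z. m z * f z) \<longlongrightarrow> 0) (filtercomap Re at_top)"
  proof (rule Lim_null_comparison)
    show "\<forall>\<^sub>F z in filtercomap Re at_top. norm (m z * f z) \<le> M * norm (f z)"
      using RHP_ev by eventually_elim (auto simp: norm_mult intro!: mult_right_mono M)
    show "((\<lambda>z. M * norm (f z)) \<longlongrightarrow> 0) (filtercomap Re at_top)"
      by (intro tendsto_mult_right_zero tendsto_norm_zero fl)
  qed
  then show ?thesis using hol bdd sn by (simp add: B0space_def Bspace_def)
qed

section \<open>Multipliers are elements of B\<close>

text \<open>The product rule solved for \<open>deriv m\<close>: \<open>f m' = (m f)' - m f'\<close>,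
  divided by \<open>f\<close> on a strip where \<open>f\<close> is bounded below. The strip enters
  the right-hand side only through \<open>\<delta>\<close>, which is what the gliding hump
  exploits.\<close>

lemma integral_deriv_sup_strip_le:
  assumes mh: "m holomorphic_on RHP" and fh: "f holomorphic_on RHP"
    and M: "0 < M" "\<And>z. z \<in> RHP \<Longrightarrow> cmod (m z) \<le> M"
    and \<delta>: "0 < \<delta>" "\<And>z. \<lbrakk>z \<in> RHP; A \<le> Re z; Re z \<le> B\<rbrakk> \<Longrightarrow> \<delta> \<le> cmod (f z)"
  shows "(\<integral>\<^sup>+ a. deriv_sup m a * indicator ({0<..} \<inter> {A..B}) a \<partial>lborel)
    \<le> ennreal (1 / \<delta>) * (B0_seminorm (\<lambda>z. m z * f z) + ennreal M * B0_seminorm f)"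
proof -
  let ?p = "\<lambda>z. m z * f z"
  have ph: "?p holomorphic_on RHP" by (intro holomorphic_intros mh fh)
  note [measurable] = measurable_deriv_sup[OF ph] measurable_deriv_sup[OF fh]
  have "(\<integral>\<^sup>+ a. deriv_sup m a * indicator ({0<..} \<inter> {A..B}) a \<partial>lborel) \<le>
    (\<integral>\<^sup>+ a. ennreal (1 / \<delta>) * (deriv_sup ?p a * indicator {0<..} a + ennreal M * (deriv_sup f a * indicator {0<..} a)) \<partial>lborel)"
  proof (rule nn_integral_mono)
    fix a :: real
    have "deriv_sup m a \<le> ennreal (1 / \<delta>) * (deriv_sup ?p a + ennreal M * deriv_sup f a)"
      if a: "0 < a" "A \<le> a" "a \<le> B"
    proof (rule deriv_sup_leI)
      fix z :: complex assume z: "Re z = a"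
      then have zR: "z \<in> RHP" using a by (simp add: RHP_def)
      have "\<delta> * cmod (deriv m z) \<le> cmod (f z) * cmod (deriv m z)"
        using \<delta>(2)[OF zR] a z by (intro mult_right_mono) auto
      also have "\<dots> = cmod (deriv ?p z - m z * deriv f z)"
        unfolding deriv_mult_RHP[OF mh fh zR] by (simp add: norm_mult)
      also have "\<dots> \<le> cmod (deriv ?p z) + cmod (m z) * cmod (deriv f z)"
        by (metis norm_mult norm_triangle_ineq4)
      also have "\<dots> \<le> cmod (deriv ?p z) + M * cmod (deriv f z)"
        using M(2)[OF zR] by (intro add_left_mono mult_right_mono) auto
      finally have "cmod (deriv m z) \<le> 1 / \<delta> * (cmod (deriv ?p z) + M * cmod (deriv f z))"
        using \<delta>(1) by (simp add: field_simps)
      then have "ennreal (cmod (deriv m z)) \<le> ennreal (1 / \<delta> * (cmod (deriv ?p z) + M * cmod (deriv f z)))"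
        by (rule ennreal_leI)
      also have "\<dots> = ennreal (1 / \<delta>) * (ennreal (cmod (deriv ?p z)) + ennreal M * ennreal (cmod (deriv f z)))"
        using M(1) \<delta>(1) by (simp add: ennreal_plus ennreal_mult del: times_divide_eq_left)
      also have "\<dots> \<le> ennreal (1 / \<delta>) * (deriv_sup ?p a + ennreal M * deriv_sup f a)"
        using deriv_le_deriv_sup z by (intro add_mono mult_left_mono) auto
      finally show "ennreal (cmod (deriv m z)) \<le> ennreal (1 / \<delta>) * (deriv_sup ?p a + ennreal M * deriv_sup f a)" .
    qed
    then show "deriv_sup m a * indicator ({0<..} \<inter> {A..B}) a \<le>
      ennreal (1 / \<delta>) * (deriv_sup ?p a * indicator {0<..} a + ennreal M * (deriv_sup f a * indicator {0<..} a))"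
      by (auto split: split_indicator)
  qed
  also have "\<dots> = ennreal (1 / \<delta>) * (B0_seminorm ?p + ennreal M * B0_seminorm f)"
    unfolding B0_seminorm_eq by (simp add: nn_integral_add nn_integral_cmult)
  finally show ?thesis .
qed

lemma bounded_of_multiplier:
  assumes m: "m \<in> Ms_B0"
  shows "bounded (m ` RHP)"
proof (rule ccontr)
  assume nb: "\<not> bounded (m ` RHP)"
  have mf: "(\<lambda>z. m z * f z) \<in> B0space" if "f \<in> B0space" for f
    using m that by (simp add: Ms_B0_def)
  obtain C where C: "0 < C" "\<And>z. z \<in> RHP \<Longrightarrow> cmod (m z * exp (- z)) \<le> C"
    using mf[OF exp_minus_in_B0space] by (auto simp: B0space_def Bspace_def elim: bounded_imageE)
  have C': "cmod (m z) \<le> C * exp (Re z)" if "z \<in> RHP" for z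
    using C(2)[OF that] by (simp add: norm_mult exp_minus field_simps norm_divide)
  have "\<exists>z\<in>RHP. x \<le> Re z \<and> real k * 4 ^ (k + 1) \<le> cmod (m z)" for k x
  proof -
    \<comment> \<open>The first entry of the maximum gives the required size. The second forces
      \<open>Re z\<close> beyond \<open>x\<close>, since \<open>m\<close> is bounded by
      \<open>C * exp (Re z)\<close>.\<close>
    obtain z where z: "z \<in> RHP" "max (real k * 4 ^ (k + 1)) (C * exp x) < cmod (m z)"
      using nb unfolding bounded_iff by (auto simp: not_le simp del: max_less_iff_conj)
    have "C * exp x < C * exp (Re z)" using z C'[OF z(1)] by simp
    then have "x < Re z" using C(1) by simp
    then show ?thesis using z by (intro bexI[of _ z]) auto
  qed
  then have "\<forall>k x. \<exists>z. z \<in> RHP \<and> x \<le> Re z \<and> real k * 4 ^ (k + 1) \<le> cmod (m z)"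
    by blast
  then obtain Z where Z: "\<And>k x. Z k x \<in> RHP" "\<And>k x. x \<le> Re (Z k x)"
    "\<And>k x. real k * 4 ^ (k + 1) \<le> cmod (m (Z k x))"
    unfolding choice_iff by blast
  \<comment> \<open>The \<open>k\<close>-th strip ends exactly on the vertical line through the
    point \<open>Z k (A k)\<close>, so the lower bound for \<open>f\<close> holds there and
    \<open>m * f\<close> has modulus at least \<open>k\<close>.\<close>
  obtain f A where f: "f \<in> B0space" and A: "\<And>k z. \<lbrakk>z \<in> RHP; A k \<le> Re z; Re z \<le> Re (Z k (A k))\<rbrakk>
      \<Longrightarrow> 1 / 4 ^ (k + 1) \<le> cmod (f z)"
    using gliding_hump_function[of "\<lambda>k x. Re (Z k x)"] Z(2) by blast
  obtain K where K: "0 < K" "\<And>z. z \<in> RHP \<Longrightarrow> cmod (m z * f z) \<le> K"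
    using mf[OF f] by (auto simp: B0space_def Bspace_def elim: bounded_imageE)
  obtain k :: nat where k: "K < k" using reals_Archimedean2 by blast
  have "real k = (real k * 4 ^ (k + 1)) * (1 / 4 ^ (k + 1))" by simp
  also have "\<dots> \<le> cmod (m (Z k (A k))) * cmod (f (Z k (A k)))"
    using Z A by (intro mult_mono) auto
  also have "\<dots> \<le> K" using K(2)[OF Z(1)] by (simp add: norm_mult)
  finally show False using k by simp
qed

text \<open>The integral over real parts up to any \<open>x\<close> is finite, so an infinite total
  leaves infinite mass beyond \<open>x\<close>. Strips of mass at least
  \<open>k * 4 ^ (k + 1)\<close> then exist arbitrarily far out, and the hump function makes the
  strip estimate fail for large \<open>k\<close>.\<close>

lemma B0_seminorm_finite_of_multiplier:
  assumes m: "m \<in> Ms_B0"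
  shows "B0_seminorm m < \<infinity>"
proof (rule ccontr)
  assume inf: "\<not> B0_seminorm m < \<infinity>"
  have mh: "m holomorphic_on RHP" using m by (simp add: Ms_B0_def)
  note [measurable] = measurable_deriv_sup[OF mh]
  obtain M where M: "0 < M" "\<And>z. z \<in> RHP \<Longrightarrow> norm (m z) \<le> M"
    using bounded_of_multiplier[OF m] by (auto elim: bounded_imageE)
  define J where "J x y = (\<integral>\<^sup>+ a. deriv_sup m a * indicator ({0<..} \<inter> {x..y}) a \<partial>lborel)" for x y
  have fin: "B0_seminorm (\<lambda>z. m z * f z) + ennreal M * B0_seminorm f < \<infinity>" if "f \<in> B0space" for f
    using m that by (auto simp: Ms_B0_def B0space_def Bspace_def ennreal_mult_less_top)
  have J_le: "J x y \<le> ennreal (1 / \<delta>) * (B0_seminorm (\<lambda>z. m z * f z) + ennreal M * B0_seminorm f)"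
    if "f \<in> B0space" "0 < \<delta>" "\<And>z. \<lbrakk>z \<in> RHP; x \<le> Re z; Re z \<le> y\<rbrakk> \<Longrightarrow> \<delta> \<le> cmod (f z)" for f x y \<delta>
    unfolding J_def using that
    by (intro integral_deriv_sup_strip_le mh M) (auto simp: B0space_def Bspace_def)
  have J0: "J 0 x < \<infinity>" for x
  proof -
    \<comment> \<open>On this strip \<open>exp (- z)\<close> has modulus at least
      \<open>exp (- x)\<close>.\<close>
    have "J 0 x \<le> ennreal (1 / exp (- x)) * (B0_seminorm (\<lambda>z. m z * exp (- z)) + ennreal M * B0_seminorm (\<lambda>z. exp (- z)))"
      by (rule J_le[OF exp_minus_in_B0space]) auto
    also have "\<dots> < \<infinity>" using fin[OF exp_minus_in_B0space] by (auto simp: ennreal_mult_less_top)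
    finally show ?thesis .
  qed
  have meas: "(\<lambda>a. deriv_sup m a * indicator ({0<..} \<inter> {x..y}) a) \<in> borel_measurable lborel" for x y
  proof -
    have "(\<lambda>a. (deriv_sup m a * indicator {0<..} a) * indicator {x..y} a) \<in> borel_measurable lborel"
      by measurable
    then show ?thesis by (simp add: indicator_inter_arith mult.assoc)
  qed
  have "\<exists>y\<ge>x. ennreal (real k * 4 ^ (k + 1)) \<le> J x y" for k x
  proof (rule ccontr)
    assume "\<not> ?thesis"
    then have small: "J x y \<le> ennreal (real k * 4 ^ (k + 1))" if "x \<le> y" for y
      using that by (meson linear)
    have Jn: "J 0 (real n) \<le> J 0 x + ennreal (real k * 4 ^ (k + 1))" for n
    proof (cases "x \<le> real n")
      case True
      have "J 0 (real n) \<le> (\<integral>\<^sup>+ a. deriv_sup m a * indicator ({0<..} \<inter> {0..x}) a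
          + deriv_sup m a * indicator ({0<..} \<inter> {x..real n}) a \<partial>lborel)"
        unfolding J_def by (rule nn_integral_mono) (auto split: split_indicator)
      also have "\<dots> = J 0 x + J x (real n)"
        unfolding J_def by (rule nn_integral_add[OF meas meas])
      also have "\<dots> \<le> J 0 x + ennreal (real k * 4 ^ (k + 1))"
        by (intro add_left_mono small True)
      finally show ?thesis .
    next
      case False
      then have "J 0 (real n) \<le> J 0 x"
        unfolding J_def by (intro nn_integral_mono) (auto split: split_indicator)
      then show ?thesis by (simp add: add_increasing2)
    qed
    \<comment> \<open>The strips with real part in \<open>(0, n]\<close> exhaust the half-plane, so
      monotone convergence turns the uniform bound on \<open>J 0 n\<close> into a finite
      seminorm.\<close>
    have "B0_seminorm m \<le> (\<integral>\<^sup>+ a. (SUP n. deriv_sup m a * indicator ({0<..} \<inter> {0..real n}) a) \<partial>lborel)"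
      unfolding B0_seminorm_eq
    proof (rule nn_integral_mono)
      fix a :: real
      obtain n :: nat where "a \<le> n" using real_arch_simple by blast
      then show "deriv_sup m a * indicator {0<..} a \<le> (SUP n. deriv_sup m a * indicator ({0<..} \<inter> {0..real n}) a)"
        by (intro SUP_upper2[of n]) (auto split: split_indicator)
    qed
    also have "\<dots> = (SUP n. J 0 (real n))"
      unfolding J_def
      by (rule nn_integral_monotone_convergence_SUP[OF _ meas]) (auto simp: incseq_def le_fun_def split: split_indicator)
    also have "\<dots> \<le> J 0 x + ennreal (real k * 4 ^ (k + 1))"
      by (rule SUP_least) (rule Jn)
    also have "\<dots> < \<infinity>" using J0[of x] by simp
    finally show False using inf by simp
  qed
  then have "\<forall>k x. \<exists>y. x \<le> y \<and> ennreal (real k * 4 ^ (k + 1)) \<le> J x y"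
    by blast
  then obtain N where N: "\<And>k x. x \<le> N k x" "\<And>k x. ennreal (real k * 4 ^ (k + 1)) \<le> J x (N k x)"
    unfolding choice_iff by blast
  obtain f A where f: "f \<in> B0space" and A: "\<And>k z. \<lbrakk>z \<in> RHP; A k \<le> Re z; Re z \<le> N k (A k)\<rbrakk>
      \<Longrightarrow> 1 / 4 ^ (k + 1) \<le> cmod (f z)"
    using gliding_hump_function[of N] N(1) by blast
  obtain K where K: "0 \<le> K" "B0_seminorm (\<lambda>z. m z * f z) + ennreal M * B0_seminorm f = ennreal K"
    using fin[OF f] by (cases "B0_seminorm (\<lambda>z. m z * f z) + ennreal M * B0_seminorm f") auto
  obtain k :: nat where k: "K < k" using reals_Archimedean2 by blast
  have "ennreal (real k * 4 ^ (k + 1)) \<le> J (A k) (N k (A k))" by (rule N(2))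
  also have "\<dots> \<le> ennreal (1 / (1 / 4 ^ (k + 1))) * ennreal K"
    unfolding K(2)[symmetric] by (rule J_le[OF f _ A]) auto
  also have "\<dots> = ennreal (4 ^ (k + 1) * K)" using K(1) by (simp add: ennreal_mult)
  finally have "real k * 4 ^ (k + 1) \<le> 4 ^ (k + 1) * K" using K(1) by simp
  then show False using k by simp
qed

section \<open>Absence of a sequential approximate unit\<close>

lemma no_sequential_approximate_unit:
  assumes F: "\<And>n. F n \<in> B0space"
    and conv: "(\<lambda>n::nat. B0_seminorm (\<lambda>z. F n z * exp (- z) - exp (- z))) \<longlonglongrightarrow> 0"
  shows False
proof -
  \<comment> \<open>On the line \<open>Re z = 1\<close> the factor \<open>exp (- z)\<close> has
    modulus \<open>exp (- 1)\<close>; dividing by it turns this threshold into 1/2. A single index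
    \<open>n\<close> suffices from here on.\<close>
  have "\<forall>\<^sub>F n in sequentially. B0_seminorm (\<lambda>z. F n z * exp (- z) - exp (- z)) < ennreal (exp (- 1) / 2)"
    using conv by (rule order_tendstoD) simp
  then obtain n where n: "B0_seminorm (\<lambda>z. F n z * exp (- z) - exp (- z)) < ennreal (exp (- 1) / 2)"
    by (auto dest: eventually_happens)
  have Fh: "F n holomorphic_on RHP" and Fl: "(F n \<longlongrightarrow> 0) (filtercomap Re at_top)"
    using F[of n] by (auto simp: B0space_def Bspace_def)
  obtain M where M: "0 < M" "\<And>z. z \<in> RHP \<Longrightarrow> cmod (F n z) \<le> M"
    using F[of n] by (auto simp: B0space_def Bspace_def elim: bounded_imageE)
  have el: "((\<lambda>z. exp (- z)) \<longlongrightarrow> (0::complex)) (filtercomap Re at_top)"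
    using exp_minus_in_B0space by (simp add: B0space_def)
  have wl: "((\<lambda>z. F n z * exp (- z) - exp (- z)) \<longlongrightarrow> 0) (filtercomap Re at_top)"
    using tendsto_diff[OF tendsto_mult[OF Fl el] el] by simp
  have wh: "(\<lambda>z. F n z * exp (- z) - exp (- z)) holomorphic_on RHP"
    by (intro holomorphic_intros Fh)
  have line: "cmod (F n z - 1) \<le> 1 / 2" if z: "Re z = 1" for z
  proof -
    have "ennreal (cmod (F n z * exp (- z) - exp (- z))) < ennreal (exp (- 1) / 2)"
      using norm_le_B0_seminorm[OF wh wl, of z] z n by (auto simp: RHP_def intro: le_less_trans)
    then have "cmod (F n z * exp (- z) - exp (- z)) < exp (- 1) / 2"
      by (simp add: ennreal_less_iff)
    also have "F n z * exp (- z) - exp (- z) = (F n z - 1) * exp (- z)" by (simp add: algebra_simps)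
    finally show ?thesis using z by (simp add: norm_mult)
  qed
  have half: "cmod (F n z - 1) \<le> 1 / 2" if "1 \<le> Re z" for z
  proof (rule halfplane_maximum_modulus[where u="\<lambda>z. F n z - 1" and c=1 and M="M + 1"])
    show "(\<lambda>z. F n z - 1) holomorphic_on {z. 1 < Re z}"
      by (intro holomorphic_intros holomorphic_on_subset[OF Fh]) (auto simp: RHP_def)
    show "continuous_on {z. 1 \<le> Re z} (\<lambda>z. F n z - 1)"
      by (intro continuous_intros holomorphic_on_imp_continuous_on holomorphic_on_subset[OF Fh]) (auto simp: RHP_def)
    fix z :: complex assume "1 \<le> Re z"
    then have "cmod (F n z) \<le> M" by (intro M(2)) (simp add: RHP_def)
    then show "cmod (F n z - 1) \<le> M + 1" using norm_triangle_ineq4[of "F n z" 1] by simp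
  qed (use line that in auto)
  \<comment> \<open>A value of modulus strictly below 1/2 cannot lie within 1/2 of 1.\<close>
  have "\<forall>\<^sub>F z in filtercomap Re at_top. cmod (F n z) < 1 / 2"
    using tendsto_norm_zero[OF Fl] by (rule order_tendstoD) simp
  moreover have "\<forall>\<^sub>F z in filtercomap Re at_top. 1 \<le> Re z"
    by (rule eventually_filtercomapI[OF eventually_ge_at_top])
  ultimately have "\<forall>\<^sub>F z in filtercomap Re at_top. cmod (F n z) < 1 / 2 \<and> 1 \<le> Re z"
    by (rule eventually_conj)
  \<comment> \<open>The filter is nontrivial because \<open>Re\<close> is surjective; this supplies
    an actual point \<open>z\<close> for the contradiction.\<close>
  moreover have "filtercomap Re at_top \<noteq> bot"
    by (intro filtercomap_neq_bot_surj surjI[of _ of_real]) auto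
  ultimately obtain z where "cmod (F n z) < 1 / 2" "1 \<le> Re z"
    by (auto dest: eventually_happens')
  then show False
    using half[of z] norm_triangle_ineq4[of "F n z" "F n z - 1"] by simp
qed

theorem mainTheorem13:
  shows "(\<nexists>F :: nat \<Rightarrow> complex \<Rightarrow> complex.
            (\<forall>n. F n \<in> B0space) \<and>
            (\<forall>g\<in>B0space. ((\<lambda>n. B0_seminorm (\<lambda>z. F n z * g z - g z)) \<longlongrightarrow> 0) sequentially))
         \<and> Ms_B0 = Bspace"
proof
  show "\<nexists>F :: nat \<Rightarrow> complex \<Rightarrow> complex.
            (\<forall>n. F n \<in> B0space) \<and>
            (\<forall>g\<in>B0space. ((\<lambda>n. B0_seminorm (\<lambda>z. F n z * g z - g z)) \<longlongrightarrow> 0) sequentially)"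
  proof clarify
    fix F :: "nat \<Rightarrow> complex \<Rightarrow> complex"
    assume F: "\<forall>n. F n \<in> B0space"
      and conv: "\<forall>g\<in>B0space. (\<lambda>n. B0_seminorm (\<lambda>z. F n z * g z - g z)) \<longlonglongrightarrow> 0"
    show False
      by (rule no_sequential_approximate_unit[OF _ bspec[OF conv exp_minus_in_B0space]]) (use F in blast)
  qed
  show "Ms_B0 = Bspace"
  proof
    show "Ms_B0 \<subseteq> Bspace"
      using bounded_of_multiplier B0_seminorm_finite_of_multiplier
      by (auto simp: Bspace_def Ms_B0_def)
    show "Bspace \<subseteq> Ms_B0"
      using mult_in_B0space by (auto simp: Ms_B0_def Bspace_def)
  qed
qed

end
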